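(* Let $f=(f_1,\ldots,f_m)\in\mathbb{Q}[x_1,\ldots,x_n]^m$, let $\mathcal{I}=\langle f_1,\ldots,f_m\rangle\subset\mathbb{Q}[x_1,\ldots,x_n]$ be a zero-dimensional ideal, and let $g\in\mathbb{Q}[x_1,\ldots,x_n]$. Let $\mathcal{B}$ be a set of monomials connected to $1$ with $|\mathcal{B}|=k$ and $|\mathcal{B}^+|=l$. Suppose the algorithm "Hermite Matrix Computation - Non Radical Case" described in the context returns $\bar{k}\le k$, a set $\bar{\mathcal{B}}\subset\mathcal{B}$ connected to $1$ with $|\bar{\mathcal{B}}|=\bar{k}$, and a matrix $\bar{H}_1^+$ with rows and columns indexed by the elements of $\bar{\mathcal{B}}^+$. If $\bar{k}\ge\dim_{\mathbb{Q}}\mathbb{Q}[x_1,\ldots,x_n]/\sqrt{\mathcal{I}}$ and the Hermite Matrix Certification algorithm described in the context, with inputs $f,g,\bar{\mathcal{B}}$ and $\bar{H}_1^+$, returns $H_1$ and $H_g$, then $\bar{\mathcal{B}}$ is a basis for $\mathbb{Q}[x_1,\ldots,x_n]/\sqrt{\mathcal{I}}$ and $$H_1=H_1^{\bar{\mathcal{B}}}(\sqrt{\mathcal{I}})\quad\text{and}\quad H_g=H_g^{\bar{\mathcal{B}}}(\sqrt{\mathcal{I}}).$$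
   Context: Extension: for a finite set $\mathcal{B}$ of monomials, $\mathcal{B}^+:=\mathcal{B}\cup\bigcup_{i=1}^n x_i\mathcal{B}$. Connected to 1: a finite set $\mathcal{B}$ of monomials is connected to $1$ if $1\in\mathcal{B}$ and every $b\in\mathrm{span}(\mathcal{B})$ can be written as $b=c+\sum_{i=1}^n x_ib_i$ with $c$ a constant and $b_i\in\mathrm{span}(\mathcal{B})$, each $b_i$ being zero or satisfying $\deg b_i<\deg b$. Hermite matrix of an ideal: for a zero-dimensional ideal $K\subset\mathbb{Q}[x_1,\ldots,x_n]$ with monomial basis $\mathcal{C}=\{x^{\beta_1},\ldots,x^{\beta_r}\}$ of $A=\mathbb{Q}[x_1,\ldots,x_n]/K$ and a polynomial $g$, $H_g^{\mathcal{C}}(K):=\left[\mathrm{Tr}(\mu_{g\,x^{\beta_i+\beta_j}})\right]_{i,j=1}^r$, where $\mu_h:A\to A$ is multiplication by $h$. Algorithm "Hermite Matrix Computation - Non Radical Case". Input: $k$, $\mathcal{B}$ as in the statement, $E,M\in\mathbb{R}_+$ and points $z_1,\ldots,z_k\in\mathbb{C}^n$ (approximate roots with accuracy bound $E$) with $\|z_i\|_\infty\le M-E$ for all $i$. Step 1. Write $\mathcal{B}^+=\{b_1,\ldots,b_l\}$ and form the $l\times l$ matrix with $(i,j)$ entry $\sum_{s=1}^k(b_ib_j)(z_s)$. Rationalize each entry: with $d_{i,j}=\deg b_i+\deg b_j$, the entry equal to $k$ (if $d_{i,j}=0$) is kept, and otherwise the entry is replaced by the rational number found by rational number reconstruction (continued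 fraction method) with denominator bound $\lceil(2E\,k\,n\,d_{i,j}M^{d_{i,j}-1})^{-1/2}\rceil$. Call the resulting rational matrix $H_1^+$ and its submatrix with rows and columns indexed by $\mathcal{B}$ call $H_1$. Step 2. Find $\bar{k}$ maximal and $\bar{\mathcal{B}}\subset\mathcal{B}$ connected to $1$ with $|\bar{\mathcal{B}}|=\bar{k}$ such that the submatrix $\bar{H}_1$ of $H_1$ with rows and columns in $\bar{\mathcal{B}}$ is a maximal non-singular submatrix, i.e. $\mathrm{rank}\,\bar{H}_1=\bar{k}=\mathrm{rank}\,H_1$. Step 3. If $\mathrm{rank}\,H_1^+>\bar{k}$ return Fail; else return $\bar{k}$, $\bar{\mathcal{B}}$ and $\bar{H}_1^+$, the submatrix of $H_1^+$ with rows and columns indexed by $\bar{\mathcal{B}}^+$. (Output thus satisfies $\mathrm{rank}\,\bar{H}_1=\mathrm{rank}\,\bar{H}_1^+=\bar{k}$.) Hermite Matrix Certification algorithm. Input: $f$, $g$, a set $\bar{\mathcal{B}}=\{x^{\beta_1},\ldots,x^{\beta_{\bar{k}}}\}$ connected to $1$, and a rational matrix $\bar{H}_1^+$ with rows and columns indexed by $\bar{\mathcal{B}}^+$. Step 1. Let $H_1$ be the $\bar{k}\times\bar{k}$ submatrix of $\bar{H}_1^+$ with rows and columns indexed by $\bar{\mathcal{B}}$; for $s=1,\ldots,n$ let $H_1^{x_s}$ be the submatrix with rows indexed by $\bar{\mathcal{B}}$ and columns indexed by $x_s\bar{\mathcal{B}}$ (the $i$-th column being that of $x_sx^{\beta_i}$).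 Step 2. If $\mathrm{rank}\,H_1=\mathrm{rank}\,\bar{H}_1^+=\bar{k}$, set $M_s:=H_1^{-1}H_1^{x_s}$ for $s=1,\ldots,n$; else return Fail. Step 3. If for some $s,i,j$ we have $x_sx^{\beta_i}=x^{\beta_j}$ but the $i$-th column of $M_s$ is not the $j$-th standard unit vector, return Fail. Step 4. Let $c_1,\ldots,c_n$ be either new parameters (indeterminates) or generic elements of $\mathbb{Q}$, and let $p(\lambda)$ be the characteristic polynomial of $\sum_{i=1}^n c_iM_i$. If $\gcd(p(\lambda),p'(\lambda))\ne1$, return Fail. Step 5. If $M_iM_j=M_jM_i$ for all $1\le i<j\le n$ and $f_i(M_1,\ldots,M_n)=0$ for $i=1,\ldots,m$, continue; else return Fail. Step 6. If for some $i,j\in\{1,\ldots,\bar{k}\}$, $\mathrm{Tr}\big((x^{\beta_i}x^{\beta_j})(M_1,\ldots,M_n)\big)\ne[H_1]_{i,j}$, where $(x^{\beta_i}x^{\beta_j})(M_1,\ldots,M_n)$ is the evaluation of the monomial at the matrices, return Fail. Step 7. Return $H_1$ and $H_g:=H_1\cdot g(M_1,\ldots,M_n)$. *)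

theory Defs
  imports
    Complex_Main
    "HOL-Library.Poly_Mapping"
    "HOL-Computational_Algebra.Polynomial_Factorial"
    "Jordan_Normal_Form.Matrix"
    "Jordan_Normal_Form.Char_Poly"
    "Jordan_Normal_Form.Gauss_Jordan_Elimination"
    "Jordan_Normal_Form.DL_Rank"
begin

section \<open>The polynomial ring\<close>

text \<open>
  The variables \<open>x\<^sub>1, \<dots>, x\<^sub>n\<close> are indexed by the elements of a finite linearly ordered type
  \<open>'n\<close> with \<open>n\<close> elements. Monomials are exponent vectors, so that their product is \<open>+\<close>, and
  rational polynomials are finitely supported functions on monomials under convolution.
\<close>

type_synonym 'n monomial = "'n \<Rightarrow>\<^sub>0 nat"
type_synonym 'n qpoly = "'n monomial \<Rightarrow>\<^sub>0 rat"

definition monom_poly :: "'n monomial \<Rightarrow> 'n qpoly" where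
  "monom_poly m = Poly_Mapping.single m 1"

definition var :: "'n \<Rightarrow> 'n monomial" where
  "var s = Poly_Mapping.single s 1"

definition const :: "rat \<Rightarrow> 'n qpoly" where
  "const c = Poly_Mapping.single 0 c"

definition scaleQ :: "rat \<Rightarrow> 'n qpoly \<Rightarrow> 'n qpoly" where
  "scaleQ c p = const c * p"

lemma vector_space_scaleQ: "vector_space (scaleQ :: rat \<Rightarrow> 'n qpoly \<Rightarrow> 'n qpoly)"
  by unfold_locales
    (simp_all add: scaleQ_def const_def algebra_simps single_add mult_single
      flip: mult.assoc)

lemma module_qpoly: "Modules.module ((*) :: 'n qpoly \<Rightarrow> 'n qpoly \<Rightarrow> 'n qpoly)"
  by unfold_locales (simp_all add: algebra_simps)

definition mono_deg :: "'n::finite monomial \<Rightarrow> nat" where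
  "mono_deg m = (\<Sum>s\<in>UNIV. Poly_Mapping.lookup m s)"

text \<open>The total degree; the zero polynomial gets degree \<open>0\<close>.\<close>

definition total_deg :: "'n::finite qpoly \<Rightarrow> nat" where
  "total_deg p = Max (insert 0 (mono_deg ` Poly_Mapping.keys p))"

definition mono_at :: "'n::finite monomial \<Rightarrow> ('n \<Rightarrow> complex) \<Rightarrow> complex" where
  "mono_at m z = (\<Prod>s\<in>UNIV. z s ^ Poly_Mapping.lookup m s)"

definition poly_at :: "'n::finite qpoly \<Rightarrow> ('n \<Rightarrow> complex) \<Rightarrow> complex" where
  "poly_at p z = (\<Sum>m\<in>Poly_Mapping.keys p. of_rat (Poly_Mapping.lookup p m) * mono_at m z)"

definition inf_norm :: "('n::finite \<Rightarrow> complex) \<Rightarrow> real" where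
  "inf_norm z = Max (range (\<lambda>s. cmod (z s)))"


section \<open>Ideals and quotients\<close>

definition ideal_gen :: "'n qpoly list \<Rightarrow> 'n qpoly set" where
  "ideal_gen f = Modules.module.span (*) (set f)"

definition radical :: "'n qpoly set \<Rightarrow> 'n qpoly set" where
  "radical K = {p. \<exists>e>0. p ^ e \<in> K}"

text \<open>
  Elements of \<open>\<rat>[x\<^sub>1,\<dots>,x\<^sub>n]/K\<close> are represented by polynomials up to congruence modulo the
  ideal \<open>K\<close>. A finite set \<open>C\<close> of polynomials is a basis of the quotient if the residue classes
  of its elements are (pairwise distinct,) linearly independent and spanning.
\<close>

definition quot_basis :: "'n qpoly set \<Rightarrow> 'n qpoly set \<Rightarrow> bool" where
  "quot_basis K C \<longleftrightarrow> finite C \<and>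
     (\<forall>u. (\<Sum>b\<in>C. scaleQ (u b) b) \<in> K \<longrightarrow> (\<forall>b\<in>C. u b = 0)) \<and>
     (\<forall>p. \<exists>u. p - (\<Sum>b\<in>C. scaleQ (u b) b) \<in> K)"

text \<open>
  An ideal is called zero-dimensional if its quotient has finite dimension over the rationals;
  the unit ideal is not excluded.
\<close>

definition zero_dimensional :: "'n qpoly set \<Rightarrow> bool" where
  "zero_dimensional K \<longleftrightarrow> (\<exists>C. quot_basis K C)"

text \<open>
  Dimension and trace are computed in an arbitrary basis of the quotient and do not depend on it.
  They are meaningful for zero-dimensional \<open>K\<close> only.
\<close>

definition quot_dim :: "'n qpoly set \<Rightarrow> nat" where
  "quot_dim K = card (SOME C. quot_basis K C)"

definition quot_coords :: "'n qpoly set \<Rightarrow> 'n qpoly set \<Rightarrow> 'n qpoly \<Rightarrow> 'n qpoly \<Rightarrow> rat" where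
  "quot_coords K C p = (SOME u. p - (\<Sum>b\<in>C. scaleQ (u b) b) \<in> K)"

text \<open>The trace of the multiplication map \<open>\<mu>\<^sub>h\<close> on the quotient by \<open>K\<close>.\<close>

definition trace_mult :: "'n qpoly set \<Rightarrow> 'n qpoly \<Rightarrow> rat" where
  "trace_mult K h = (let C = (SOME C. quot_basis K C) in \<Sum>b\<in>C. quot_coords K C (h * b) b)"

text \<open>The list \<open>bs\<close> enumerates the monomial basis, which thereby indexes rows and columns.\<close>

definition hermite_matrix :: "'n qpoly set \<Rightarrow> 'n monomial list \<Rightarrow> 'n qpoly \<Rightarrow> rat mat" where
  "hermite_matrix K bs g =
     mat (length bs) (length bs) (\<lambda>(i, j). trace_mult K (g * monom_poly (bs ! i + bs ! j)))"


section \<open>Sets of monomials\<close>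

definition extension :: "'n monomial set \<Rightarrow> 'n monomial set" where
  "extension B = B \<union> (\<Union>s. (\<lambda>b. var s + b) ` B)"

definition connected_to_one :: "'n::finite monomial set \<Rightarrow> bool" where
  "connected_to_one B \<longleftrightarrow> finite B \<and> 0 \<in> B \<and>
     (\<forall>b \<in> Modules.module.span scaleQ (monom_poly ` B).
        \<exists>c h. b = const c + (\<Sum>s\<in>UNIV. monom_poly (var s) * h s) \<and>
          (\<forall>s. h s \<in> Modules.module.span scaleQ (monom_poly ` B) \<and>
               (h s = 0 \<or> total_deg (h s) < total_deg b)))"


section \<open>Matrices indexed by monomials\<close>

text \<open>
  A matrix with rows and columns indexed by monomials is a function of two monomials, of which
  only the values on the index sets in question matter. Enumerating the index sets turns it into
  a matrix in the sense of the library.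
\<close>

definition submat :: "'n monomial list \<Rightarrow> 'n monomial list \<Rightarrow>
    ('n monomial \<Rightarrow> 'n monomial \<Rightarrow> rat) \<Rightarrow> rat mat" where
  "submat rs cs H = mat (length rs) (length cs) (\<lambda>(i, j). H (rs ! i) (cs ! j))"

text \<open>
  The rank of the square submatrix with rows and columns indexed by \<open>B\<close>. It does not depend on
  the enumeration of \<open>B\<close>; the one used here comes from the linear order on exponent vectors.
\<close>

definition rank_on :: "'n::linorder monomial set \<Rightarrow>
    ('n monomial \<Rightarrow> 'n monomial \<Rightarrow> rat) \<Rightarrow> nat" where
  "rank_on B H = (let bs = sorted_list_of_set B in vec_space.rank (card B) (submat bs bs H))"

definition mat_trace :: "rat mat \<Rightarrow> rat" where
  "mat_trace A = (\<Sum>i<dim_row A. A $$ (i, i))"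

text \<open>
  Evaluation at a tuple of \<open>k \<times> k\<close> matrices. The factors of a monomial are multiplied in the
  order of the variables, which is immaterial for commuting matrices.
\<close>

definition mono_at_mats :: "nat \<Rightarrow> 'n::{finite,linorder} monomial \<Rightarrow> ('n \<Rightarrow> rat mat) \<Rightarrow> rat mat"
  where
  "mono_at_mats k m X =
     foldr (\<lambda>s A. (X s ^\<^sub>m Poly_Mapping.lookup m s) * A) (sorted_list_of_set UNIV) (1\<^sub>m k)"

definition poly_at_mats :: "nat \<Rightarrow> 'n::{finite,linorder} qpoly \<Rightarrow> ('n \<Rightarrow> rat mat) \<Rightarrow> rat mat"
  where
  "poly_at_mats k p X =
     mat k k (\<lambda>ij. \<Sum>m\<in>Poly_Mapping.keys p. Poly_Mapping.lookup p m * mono_at_mats k m X $$ ij)"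


section \<open>Hermite matrix computation, non-radical case\<close>

text \<open>
  The \<open>i\<close>-th convergent of the simple continued fraction expansion of a real number. For a
  rational number the sequence of convergents becomes stationary when the expansion ends.
\<close>

primrec convergent_cf :: "nat \<Rightarrow> real \<Rightarrow> rat" where
  "convergent_cf 0 a = of_int \<lfloor>a\<rfloor>"
| "convergent_cf (Suc i) a =
     (if frac a = 0 then of_int \<lfloor>a\<rfloor> else of_int \<lfloor>a\<rfloor> + 1 / convergent_cf i (1 / frac a))"

definition denom :: "rat \<Rightarrow> int" where
  "denom r = snd (quotient_of r)"

text \<open>
  Rational number reconstruction with denominator bound \<open>N\<close>: the last convergent with denominator
  at most \<open>N\<close>. If there is a rational \<open>r\<close> with denominator at most \<open>N\<close> and
  \<open>\<bar>a - r\<bar> < 1 / (2 * N\<^sup>2)\<close>, then it is unique and is this convergent.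
\<close>

definition reconstructs :: "real \<Rightarrow> int \<Rightarrow> rat \<Rightarrow> bool" where
  "reconstructs a N r \<longleftrightarrow>
     (\<exists>i. r = convergent_cf i a \<and> denom r \<le> N \<and>
       (\<forall>j>i. convergent_cf j a = r \<or> denom (convergent_cf j a) > N))"

definition denom_bound :: "nat \<Rightarrow> nat \<Rightarrow> real \<Rightarrow> real \<Rightarrow> nat \<Rightarrow> int" where
  "denom_bound k n E M d =
     \<lceil>(2 * E * real k * real n * real d * M ^ (d - 1)) powr (- 1 / 2)\<rceil>"

text \<open>
  The power sums of the approximate roots are complex numbers near rational ones; it is their
  real part that is reconstructed.
\<close>

definition rationalized_entry :: "nat \<Rightarrow> real \<Rightarrow> real \<Rightarrow> (nat \<Rightarrow> 'n::finite \<Rightarrow> complex) \<Rightarrow>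
    'n monomial \<Rightarrow> 'n monomial \<Rightarrow> rat \<Rightarrow> bool" where
  "rationalized_entry k E M z a b r \<longleftrightarrow>
     (let d = mono_deg a + mono_deg b in
      if d = 0 then r = of_nat k
      else reconstructs (Re (\<Sum>s<k. mono_at (a + b) (z s)))
             (denom_bound k (card (UNIV :: 'n set)) E M d) r)"

text \<open>
  The algorithm leaves choices open, so that it is given as a relation between its input
  \<open>k, B, E, M, z\<close> and its possible outputs \<open>kb, Bb, Hb\<close> other than Fail; here \<open>H\<close> is the
  matrix \<open>H\<^sub>1\<^sup>+\<close>. The maximality of \<open>kb\<close> amounts to its being the rank of \<open>H\<^sub>1\<close>.
\<close>

definition hermite_computation_returns ::
    "nat \<Rightarrow> 'n::{finite,linorder} monomial set \<Rightarrow> real \<Rightarrow> real \<Rightarrow> (nat \<Rightarrow> 'n \<Rightarrow> complex) \<Rightarrow>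
     nat \<Rightarrow> 'n monomial set \<Rightarrow> ('n monomial \<Rightarrow> 'n monomial \<Rightarrow> rat) \<Rightarrow> bool" where
  "hermite_computation_returns k B E M z kb Bb Hb \<longleftrightarrow>
     (\<exists>H. (\<forall>a \<in> extension B. \<forall>b \<in> extension B. rationalized_entry k E M z a b (H a b)) \<and>
          Bb \<subseteq> B \<and> connected_to_one Bb \<and> card Bb = kb \<and>
          rank_on Bb H = kb \<and> rank_on B H = kb \<and>
          \<not> rank_on (extension B) H > kb \<and>
          (\<forall>a \<in> extension Bb. \<forall>b \<in> extension Bb. Hb a b = H a b))"


section \<open>Hermite matrix certification\<close>

text \<open>
  The test on the characteristic polynomial of the combination of the matrices \<open>X s\<close> with
  coefficients \<open>c s\<close> in an extension field of the rationals, \<open>emb\<close> being the embedding of the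
  rationals. For polynomials over a field, \<open>gcd p p' = 1\<close> is the same as \<open>coprime p p'\<close>; the
  function \<open>gcd\<close> itself is not available over \<open>fract\<close>.
\<close>

definition separating_comb :: "nat \<Rightarrow> (rat \<Rightarrow> 'a::field) \<Rightarrow> ('n::finite \<Rightarrow> 'a) \<Rightarrow>
    ('n \<Rightarrow> rat mat) \<Rightarrow> bool" where
  "separating_comb k emb c X \<longleftrightarrow>
     (let p = char_poly (mat k k (\<lambda>ij. \<Sum>s\<in>UNIV. c s * emb (X s $$ ij)))
      in coprime p (pderiv p))"

text \<open>
  The coefficients are either the indeterminates of the rational function field in \<open>n\<close> variables
  or some choice of rational numbers for which the test succeeds.
\<close>

definition separation_test :: "nat \<Rightarrow> ('n::{finite,linorder} \<Rightarrow> rat mat) \<Rightarrow> bool" where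
  "separation_test k X \<longleftrightarrow>
     separating_comb k (\<lambda>q. to_fract (const q)) (\<lambda>s. to_fract (monom_poly (var s) :: 'n qpoly)) X \<or>
     (\<exists>c. separating_comb k (\<lambda>q. q) c X)"

text \<open>
  The relation between the input \<open>f, g, bs, Hb\<close> and the output \<open>H1, Hg\<close> other than Fail; the list
  \<open>bs\<close> enumerates the set of monomials given to the algorithm.
\<close>

definition hermite_certification_returns ::
    "'n::{finite,linorder} qpoly list \<Rightarrow> 'n qpoly \<Rightarrow> 'n monomial list \<Rightarrow>
     ('n monomial \<Rightarrow> 'n monomial \<Rightarrow> rat) \<Rightarrow> rat mat \<Rightarrow> rat mat \<Rightarrow> bool" where
  "hermite_certification_returns f g bs Hb H1 Hg \<longleftrightarrow>
     (let k = length bs;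
          X = (\<lambda>s. the (mat_inverse H1) * submat bs (map (\<lambda>b. var s + b) bs) Hb)
      in H1 = submat bs bs Hb \<and>
         vec_space.rank k H1 = k \<and> rank_on (extension (set bs)) Hb = k \<and>
         (\<forall>s. \<forall>i<k. \<forall>j<k. var s + bs ! i = bs ! j \<longrightarrow> col (X s) i = unit_vec k j) \<and>
         separation_test k X \<and>
         (\<forall>s t. s < t \<longrightarrow> X s * X t = X t * X s) \<and>
         (\<forall>p \<in> set f. poly_at_mats k p X = 0\<^sub>m k k) \<and>
         (\<forall>i<k. \<forall>j<k. mat_trace (mono_at_mats k (bs ! i + bs ! j) X) = H1 $$ (i, j)) \<and>
         Hg = H1 * poly_at_mats k g X)"

end

theory Submission
  imports Defs "Jordan_Normal_Form.Schur_Decomposition"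
begin

text \<open>
  Let \<open>J\<close> be the ideal of all \<open>p\<close> with \<open>p(X) = 0\<close> for the certified commuting matrices \<open>X\<close>. As the
  monomials are connected to \<open>1\<close> and the columns of \<open>X\<close> pass the unit vector test, the column of
  \<open>b(X)\<close> indexed by \<open>1\<close> is the unit vector of \<open>b\<close>, for each monomial \<open>b\<close>. Hence the monomials are a
  basis modulo \<open>J\<close>, and \<open>p(X)\<close> is the matrix of multiplication by \<open>p\<close>. By the trace test, the
  non-singular matrix \<open>H\<^sub>1\<close> is the Gram matrix of the trace form modulo \<open>J\<close>. If \<open>q\<^sup>2 \<in> J\<close>, every
  \<open>(q b)(X)\<close> has square zero and therefore trace zero, so \<open>q\<close> is orthogonal to all \<open>b\<close> and lies in \<open>J\<close>.
  Thus \<open>J\<close> is radical and contains the radical of \<open>\<langle>f\<rangle>\<close>; comparing dimensions shows that they are equal.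
\<close>

section \<open>Square-zero matrices have trace zero\<close>

lemma sum_diag_mult_commute:
  fixes A B :: "'a::comm_semiring_0 mat"
  assumes A: "A \<in> carrier_mat n m" and B: "B \<in> carrier_mat m n"
  shows "(\<Sum>i<n. (A * B) $$ (i, i)) = (\<Sum>j<m. (B * A) $$ (j, j))"
proof -
  have "(\<Sum>i<n. (A * B) $$ (i, i)) = (\<Sum>i<n. \<Sum>j<m. A $$ (i, j) * B $$ (j, i))"
    using A B by (auto simp: scalar_prod_def lessThan_atLeast0 intro!: sum.cong)
  also have "\<dots> = (\<Sum>j<m. \<Sum>i<n. B $$ (j, i) * A $$ (i, j))"
    by (subst sum.swap) (simp add: mult.commute)
  also have "\<dots> = (\<Sum>j<m. (B * A) $$ (j, j))"
    using A B by (auto simp: scalar_prod_def lessThan_atLeast0 intro!: sum.cong)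
  finally show ?thesis .
qed

text \<open>In a diagonal entry of \<open>B * B\<close>, every product with \<open>j\<close>
  different from \<open>i\<close> has a factor below the diagonal; only the square of
  \<open>B $$ (i, i)\<close> is left.\<close>

lemma upper_triangular_square_zero_diag:
  fixes B :: "'a::idom mat"
  assumes B: "B \<in> carrier_mat n n" and ut: "upper_triangular B" and sq: "B * B = 0\<^sub>m n n"
    and i: "i < n"
  shows "B $$ (i, i) = 0"
proof -
  have "0 = (B * B) $$ (i, i)"
    using i by (simp add: sq)
  also have "\<dots> = (\<Sum>j\<in>{0..<n}. B $$ (i, j) * B $$ (j, i))"
    using B i by (simp add: scalar_prod_def)
  also have "\<dots> = (\<Sum>j\<in>{0..<n}. if j = i then B $$ (i, i) * B $$ (i, i) else 0)"
  proof (rule sum.cong[OF refl])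
    fix j assume "j \<in> {0..<n}"
    then show "B $$ (i, j) * B $$ (j, i) = (if j = i then B $$ (i, i) * B $$ (i, i) else 0)"
      using ut B i by (cases i j rule: linorder_cases) (auto dest: upper_triangularD)
  qed
  also have "\<dots> = B $$ (i, i) * B $$ (i, i)"
    using i by simp
  finally show ?thesis by simp
qed

text \<open>Over the complex numbers the characteristic polynomial splits, so \<open>A\<close> is
  similar to an upper triangular \<open>B\<close>. Similarity preserves the trace and the vanishing
  of the square.\<close>

lemma trace_square_zero_complex:
  fixes A :: "complex mat"
  assumes A: "A \<in> carrier_mat n n" and sq: "A * A = 0\<^sub>m n n"
  shows "(\<Sum>i<n. A $$ (i, i)) = 0"
proof -
  obtain es where "char_poly A = (\<Prod>a\<leftarrow>es. [:- a, 1:])"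
    using char_poly_factorized[OF A] by blast
  then obtain B where B: "B \<in> carrier_mat n n" and ut: "upper_triangular B" and "similar_mat A B"
    using schur_decomposition_exists[OF A] by blast
  then obtain P Q where "similar_mat_wit A B P Q"
    by (auto simp: similar_mat_def)
  from similar_mat_witD2[OF A this] have P: "P \<in> carrier_mat n n" and Q: "Q \<in> carrier_mat n n"
    and QP: "Q * P = 1\<^sub>m n" and AB: "A = P * B * Q"
    by auto
  have BQA: "B = Q * (A * P)"
  proof -
    have "Q * (A * P) = (Q * P) * B * (Q * P)"
      unfolding AB using P Q B by (simp add: assoc_mult_mat[of _ n n _ n _ n])
    then show ?thesis
      using B by (simp add: QP)
  qed
  have BPQ: "B = Q * A * P"
    using BQA P Q A by (simp add: assoc_mult_mat[of _ n n _ n _ n])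
  have PQ: "P * Q = 1\<^sub>m n"
    using mat_mult_left_right_inverse[OF Q P QP] .
  have "B * B = Q * A * (P * Q) * A * P"
    unfolding BPQ using P Q A by (simp add: assoc_mult_mat[of _ n n _ n _ n])
  also have "\<dots> = Q * (A * A) * P"
    unfolding PQ using P Q A by (simp add: assoc_mult_mat[of _ n n _ n _ n])
  also have "\<dots> = 0\<^sub>m n n"
    unfolding sq using P Q by simp
  finally have BB: "B * B = 0\<^sub>m n n" .
  have "(\<Sum>i<n. A $$ (i, i)) = (\<Sum>i<n. (Q * (P * B)) $$ (i, i))"
    unfolding AB using P Q B by (intro sum_diag_mult_commute) auto
  also have "Q * (P * B) = B"
    using P Q B QP by (simp flip: assoc_mult_mat[of _ n n _ n _ n])
  also have "(\<Sum>i<n. B $$ (i, i)) = 0"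
    using upper_triangular_square_zero_diag[OF B ut BB] by simp
  finally show ?thesis .
qed

text \<open>Embedding the rationals into the complex numbers makes triangularization
  available.\<close>

lemma mat_trace_square_zero:
  assumes A: "A \<in> carrier_mat n n" and sq: "A * A = 0\<^sub>m n n"
  shows "mat_trace A = 0"
proof -
  let ?A = "map_mat of_rat A :: complex mat"
  have "?A * ?A = map_mat of_rat (A * A)"
    using A by (simp add: of_rat_hom.mat_hom_mult)
  also have "\<dots> = 0\<^sub>m n n"
    unfolding sq by (rule eq_matI) auto
  finally have "(\<Sum>i<n. ?A $$ (i, i)) = 0"
    using A by (intro trace_square_zero_complex) auto
  moreover have "(\<Sum>i<n. ?A $$ (i, i)) = of_rat (mat_trace A)"
    using A by (simp add: mat_trace_def of_rat_sum)
  ultimately show ?thesis by simp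
qed


section \<open>Polynomials in commuting matrices\<close>

lemma qpoly_induct [case_names zero single add]:
  fixes p :: "'n qpoly"
  assumes "P 0" and "\<And>m c. P (Poly_Mapping.single m c)"
    and "\<And>p q. P p \<Longrightarrow> P q \<Longrightarrow> P (p + q)"
  shows "P p"
proof (induction p rule: update_induct)
  case const
  show ?case by fact
next
  case (update f a b)
  \<comment> \<open>As \<open>a\<close> is not yet a key of \<open>f\<close>, the update amounts to
    adding a term.\<close>
  have "Poly_Mapping.update a b f = f + Poly_Mapping.single a b"
    using update(1)
    by (intro poly_mapping_eqI) (auto simp: lookup_add lookup_single lookup_update when_def in_keys_iff)
  then show ?case
    using assms(2,3) update.IH by metis
qed

text \<open>Commutativity makes evaluation at \<open>X\<close> a ring homomorphism, although
  \<open>mono_at_mats\<close> multiplies the factors in a fixed order.\<close>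

locale commuting_matrices =
  fixes k :: nat and X :: "'n::{finite,linorder} \<Rightarrow> rat mat"
  assumes X_carrier [simp, intro]: "X s \<in> carrier_mat k k"
    and X_commute: "X s * X t = X t * X s"
begin

lemma pow_commute:
  assumes Y: "Y \<in> carrier_mat k k" and comm: "X s * Y = Y * X s"
  shows "X s ^\<^sub>m a * Y = Y * X s ^\<^sub>m a"
proof (induction a)
  case 0
  show ?case using Y X_carrier[of s] by (simp add: carrier_matD[OF X_carrier])
next
  case (Suc a)
  have "X s ^\<^sub>m Suc a * Y = X s ^\<^sub>m a * (X s * Y)"
    using Y by (simp add: assoc_mult_mat[of _ k k _ k _ k])
  also have "\<dots> = (X s ^\<^sub>m a * Y) * X s"
    unfolding comm using Y by (simp add: assoc_mult_mat[of _ k k _ k _ k])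
  also have "\<dots> = Y * X s ^\<^sub>m Suc a"
    unfolding Suc.IH using Y by (simp add: assoc_mult_mat[of _ k k _ k _ k])
  finally show ?case .
qed

lemma pow_add: "X s ^\<^sub>m (a + b) = X s ^\<^sub>m a * X s ^\<^sub>m b"
  by (induction b) (simp_all add: right_mult_one_mat[of _ k k] carrier_matD[OF X_carrier]
      assoc_mult_mat[of _ k k _ k _ k])

lemma foldr_carrier:
  "foldr (\<lambda>s A. (X s ^\<^sub>m e s) * A) xs (1\<^sub>m k) \<in> carrier_mat k k"
  by (induction xs) (auto intro: mult_carrier_mat[of _ k k])

lemma foldr_commute:
  assumes Y: "Y \<in> carrier_mat k k" and comm: "\<And>s. X s * Y = Y * X s"
  shows "Y * foldr (\<lambda>s A. (X s ^\<^sub>m e s) * A) xs (1\<^sub>m k) =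
    foldr (\<lambda>s A. (X s ^\<^sub>m e s) * A) xs (1\<^sub>m k) * Y" (is "Y * ?F xs = ?F xs * Y")
proof (induction xs)
  case Nil
  show ?case using Y by simp
next
  case (Cons s xs)
  have "Y * ?F (s # xs) = Y * X s ^\<^sub>m e s * ?F xs"
    using Y foldr_carrier[of e xs] by (simp add: assoc_mult_mat[of _ k k _ k _ k])
  also have "\<dots> = X s ^\<^sub>m e s * (Y * ?F xs)"
    using pow_commute[OF Y comm, of s "e s"] Y foldr_carrier[of e xs]
    by (simp add: assoc_mult_mat[of _ k k _ k _ k, symmetric])
  also have "\<dots> = ?F (s # xs) * Y"
    unfolding Cons.IH using Y foldr_carrier[of e xs]
    by (simp add: assoc_mult_mat[of _ k k _ k _ k])
  finally show ?case .
qed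

text \<open>Collecting the two powers of \<open>X s\<close> means moving one of them past the
  remaining powers for \<open>e\<close>, which is where commutativity enters. The lemma makes
  evaluation multiplicative on monomials.\<close>

lemma foldr_add:
  "foldr (\<lambda>s A. (X s ^\<^sub>m (e s + e' s)) * A) xs (1\<^sub>m k) =
    foldr (\<lambda>s A. (X s ^\<^sub>m e s) * A) xs (1\<^sub>m k) * foldr (\<lambda>s A. (X s ^\<^sub>m e' s) * A) xs (1\<^sub>m k)"
proof (induction xs)
  case Nil
  show ?case by simp
next
  case (Cons s xs)
  let ?F = "\<lambda>e xs. foldr (\<lambda>s A. (X s ^\<^sub>m e s) * A) xs (1\<^sub>m k)"
  note assoc = assoc_mult_mat[of _ k k _ k _ k]
  have F: "?F e xs \<in> carrier_mat k k" for e xs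
    by (rule foldr_carrier)
  have comm: "X s ^\<^sub>m b * ?F e xs = ?F e xs * X s ^\<^sub>m b" for b
    by (rule foldr_commute) (auto simp: pow_commute X_commute)
  have "?F (\<lambda>s. e s + e' s) (s # xs) = (X s ^\<^sub>m e s * X s ^\<^sub>m e' s) * (?F e xs * ?F e' xs)"
    using Cons.IH by (simp add: pow_add)
  also have "\<dots> = X s ^\<^sub>m e s * (X s ^\<^sub>m e' s * ?F e xs) * ?F e' xs"
    by (simp add: assoc F mult_carrier_mat[of _ k k _ k])
  also have "\<dots> = ?F e (s # xs) * ?F e' (s # xs)"
    unfolding comm by (simp add: assoc F mult_carrier_mat[of _ k k _ k])
  finally show ?case .
qed

lemma mono_at_mats_carrier [simp, intro]: "mono_at_mats k m X \<in> carrier_mat k k"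
  unfolding mono_at_mats_def by (rule foldr_carrier)

lemma mono_at_mats_add: "mono_at_mats k (a + b) X = mono_at_mats k a X * mono_at_mats k b X"
  unfolding mono_at_mats_def lookup_add by (rule foldr_add)

lemma mono_at_mats_0: "mono_at_mats k 0 X = 1\<^sub>m k"
proof -
  have "foldr (\<lambda>s A. (X s ^\<^sub>m 0) * A) xs (1\<^sub>m k) = 1\<^sub>m k" for xs :: "'n list"
    by (induction xs) (simp_all add: carrier_matD[OF X_carrier])
  then show ?thesis by (simp add: mono_at_mats_def)
qed

lemma mono_at_mats_var: "mono_at_mats k (var t) X = X t"
proof -
  have "foldr (\<lambda>s A. (X s ^\<^sub>m Poly_Mapping.lookup (var t) s) * A) xs (1\<^sub>m k) = (if t \<in> set xs then X t else 1\<^sub>m k)"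
    if "distinct xs" for xs
    using that
    by (induction xs) (auto simp: var_def lookup_single when_def carrier_matD[OF X_carrier]
        left_mult_one_mat[of _ k k] right_mult_one_mat[of _ k k])
  from this[of "sorted_list_of_set UNIV"] show ?thesis
    by (simp add: mono_at_mats_def)
qed

lemma poly_at_mats_carrier [simp, intro]: "poly_at_mats k p X \<in> carrier_mat k k"
  by (simp add: poly_at_mats_def)

lemma poly_at_mats_dim [simp]:
  "dim_row (poly_at_mats k p X) = k" "dim_col (poly_at_mats k p X) = k"
  by (simp_all add: poly_at_mats_def)

lemma poly_at_mats_index:
  assumes "finite S" and "Poly_Mapping.keys p \<subseteq> S" and "i < k" and "j < k"
  shows "poly_at_mats k p X $$ (i, j) = (\<Sum>m\<in>S. Poly_Mapping.lookup p m * mono_at_mats k m X $$ (i, j))"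
  using assms by (auto simp: poly_at_mats_def in_keys_iff intro!: sum.mono_neutral_left)

lemma poly_at_mats_0: "poly_at_mats k 0 X = 0\<^sub>m k k"
  by (rule eq_matI) (auto simp: poly_at_mats_def)

lemma poly_at_mats_single:
  "poly_at_mats k (Poly_Mapping.single m c) X = c \<cdot>\<^sub>m mono_at_mats k m X"
  by (rule eq_matI) (auto simp: poly_at_mats_def carrier_matD[OF mono_at_mats_carrier])

lemma poly_at_mats_monom: "poly_at_mats k (monom_poly m) X = mono_at_mats k m X"
  unfolding monom_poly_def poly_at_mats_single by (rule eq_matI) auto

lemma poly_at_mats_add:
  "poly_at_mats k (p + q) X = poly_at_mats k p X + poly_at_mats k q X"
proof (rule eq_matI)
  fix i j assume "i < dim_row (poly_at_mats k p X + poly_at_mats k q X)"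
    and "j < dim_col (poly_at_mats k p X + poly_at_mats k q X)"
  then have "i < k" "j < k" by auto
  let ?S = "Poly_Mapping.keys p \<union> Poly_Mapping.keys q"
  have "Poly_Mapping.keys (p + q) \<subseteq> ?S"
    by (rule keys_add)
  then show "poly_at_mats k (p + q) X $$ (i, j) = (poly_at_mats k p X + poly_at_mats k q X) $$ (i, j)"
    using \<open>i < k\<close> \<open>j < k\<close>
    by (simp add: poly_at_mats_index[of ?S] lookup_add sum.distrib distrib_right)
qed auto

text \<open>Both sides are bilinear, so a nested induction reduces the claim to single terms, where
  \<open>mono_at_mats_add\<close> applies.\<close>

lemma poly_at_mats_mult:
  "poly_at_mats k (p * q) X = poly_at_mats k p X * poly_at_mats k q X"
proof (induction p rule: qpoly_induct)
  case zero
  show ?case by (simp add: poly_at_mats_0 left_mult_zero_mat[of _ k k])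
next
  case (add p p')
  then show ?case
    by (simp add: poly_at_mats_add distrib_right add_mult_distrib_mat[of _ k k _ _ k])
next
  case (single m c)
  show ?case
  proof (induction q rule: qpoly_induct)
    case zero
    show ?case by (simp add: poly_at_mats_0 right_mult_zero_mat[of _ k k])
  next
    case (add q q')
    then show ?case
      by (simp add: poly_at_mats_add distrib_left mult_add_distrib_mat[of _ k k _ k])
  next
    case (single m' c')
    have "a \<cdot>\<^sub>m (b \<cdot>\<^sub>m A) = (a * b) \<cdot>\<^sub>m A" for a b :: rat and A
      by (rule eq_matI) auto
    then show ?case
      by (simp add: mult_single poly_at_mats_single mono_at_mats_add
          mult_smult_assoc_mat[of _ k k _ k] mult_smult_distrib[of _ k k _ k] mult.commute[of c' c])
  qed
qed

lemma poly_at_mats_scaleQ: "poly_at_mats k (scaleQ c p) X = c \<cdot>\<^sub>m poly_at_mats k p X"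
  by (simp add: scaleQ_def const_def poly_at_mats_mult poly_at_mats_single mono_at_mats_0
      mult_smult_assoc_mat[of _ k k _ k] left_mult_one_mat[of _ k k])

lemma poly_at_mats_uminus: "poly_at_mats k (- p) X = - poly_at_mats k p X"
  by (rule eq_matI) (auto simp: poly_at_mats_def sum_negf)

lemma poly_at_mats_diff:
  "poly_at_mats k (p - q) X = poly_at_mats k p X - poly_at_mats k q X"
  using poly_at_mats_add[of p "- q"] 
  by (simp add: poly_at_mats_uminus minus_add_uminus_mat[of _ k k])

lemma poly_at_mats_sum_index:
  assumes "i < k" and "j < k"
  shows "poly_at_mats k (sum p S) X $$ (i, j) = (\<Sum>x\<in>S. poly_at_mats k (p x) X $$ (i, j))"
  using assms by (induction S rule: infinite_finite_induct) (simp_all add: poly_at_mats_0 poly_at_mats_add)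

end


section \<open>The quotient described by multiplication matrices\<close>

lemma keys_span_monom_poly:
  assumes "p \<in> Modules.module.span scaleQ (monom_poly ` B)"
  shows "Poly_Mapping.keys p \<subseteq> B"
proof -
  interpret vector_space scaleQ
    by (rule vector_space_scaleQ)
  show ?thesis
    using assms
  proof (induction p rule: span_induct_alt)
    case base
    show ?case by simp
  next
    case (step c x y)
    then obtain b where "b \<in> B" and "x = monom_poly b"
      by blast
    then have "Poly_Mapping.keys (scaleQ c x) \<subseteq> B"
      by (simp add: scaleQ_def const_def monom_poly_def mult_single)
    then show ?case
      using step keys_add[of "scaleQ c x" y] by blast
  qed
qed

text \<open>Compare the coefficients at \<open>b\<close> in the decomposition of
  \<open>monom_poly b\<close>: the constant contributes nothing because \<open>b\<close> is not 1,
  so \<open>b\<close> occurs in some \<open>x_s h_s\<close>, and the support of \<open>h_s\<close>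
  lies in \<open>B\<close>. This brings connectedness into a form suited to induction on the
  degree.\<close>

lemma connected_to_one_predecessor:
  assumes conn: "connected_to_one B" and b: "b \<in> B" "b \<noteq> 0"
  obtains s b' where "b' \<in> B" and "b = var s + b'"
proof -
  interpret vector_space scaleQ
    by (rule vector_space_scaleQ)
  have "monom_poly b \<in> span (monom_poly ` B)"
    using b by (intro span_base) auto
  then obtain c h where eq: "monom_poly b = const c + (\<Sum>s\<in>UNIV. monom_poly (var s) * h s)"
    and h: "\<And>s. h s \<in> span (monom_poly ` B)"
    using conn unfolding connected_to_one_def by meson
  have "Poly_Mapping.lookup (monom_poly b) b = 1"
    by (simp add: monom_poly_def)
  moreover have "Poly_Mapping.lookup (const c) b = 0"
    using b by (simp add: const_def lookup_single)
  ultimately have "(\<Sum>s\<in>UNIV. Poly_Mapping.lookup (monom_poly (var s) * h s) b) \<noteq> 0"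
    unfolding eq by (simp add: lookup_add lookup_sum)
  then obtain s where "b \<in> Poly_Mapping.keys (monom_poly (var s) * h s)"
    by (meson in_keys_iff sum.neutral)
  then obtain b' where "b = var s + b'" and "b' \<in> Poly_Mapping.keys (h s)"
    using keys_mult[of "monom_poly (var s)" "h s"] by (auto simp: monom_poly_def)
  moreover have "Poly_Mapping.keys (h s) \<subseteq> B"
    using keys_span_monom_poly h by blast
  ultimately show thesis
    using that by blast
qed

lemma mono_deg_var_add: "mono_deg (var s + b) = Suc (mono_deg b)"
  by (simp add: mono_deg_def lookup_add sum.distrib var_def lookup_single when_def)

text \<open>The assumptions abstract from what the certification provides; \<open>X s\<close> turns
  out to be the matrix of multiplication by \<open>x_s\<close> in the basis
  \<open>bs\<close>.\<close>

locale multiplication_matrices = commuting_matrices k X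
  for k :: nat and X :: "'n::{finite,linorder} \<Rightarrow> rat mat" +
  fixes bs :: "'n monomial list"
  assumes distinct: "distinct bs" and length: "length bs = k"
    and connected: "connected_to_one (set bs)"
    and col_X: "\<And>s i j. i < k \<Longrightarrow> j < k \<Longrightarrow> var s + bs ! i = bs ! j \<Longrightarrow> col (X s) i = unit_vec k j"
begin

text \<open>The ideal \<open>J\<close> of the overview, that is, the kernel of evaluation at
  \<open>X\<close>.\<close>

definition vanishing :: "'n qpoly set" where
  "vanishing = {p. poly_at_mats k p X = 0\<^sub>m k k}"

definition index_one :: nat where
  "index_one = (THE i. i < k \<and> bs ! i = 0)"

text \<open>The coordinates of the residue class of \<open>p\<close>: the column of \<open>p(X)\<close> indexed by the monomial \<open>1\<close>.\<close>

definition coord :: "'n qpoly \<Rightarrow> nat \<Rightarrow> rat" where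
  "coord p i = poly_at_mats k p X $$ (i, index_one)"

section \<open>Coordinates and multiplication\<close>

lemma index_one: "index_one < k" "bs ! index_one = 0"
proof -
  have "\<exists>!i. i < k \<and> bs ! i = 0"
    using connected distinct distinct_Ex1[of bs 0] by (simp add: connected_to_one_def length)
  from theI'[OF this] show "index_one < k" "bs ! index_one = 0"
    by (simp_all add: index_one_def)
qed

lemma index_basis:
  assumes "b \<in> set bs"
  obtains j where "j < k" and "bs ! j = b"
  using assms by (auto simp: in_set_conv_nth length)

lemma basis_in_set: "i < k \<Longrightarrow> bs ! i \<in> set bs"
  by (simp add: length)

lemma coord_add: "i < k \<Longrightarrow> coord (p + q) i = coord p i + coord q i"
  using index_one by (simp add: coord_def poly_at_mats_add)

lemma coord_diff: "i < k \<Longrightarrow> coord (p - q) i = coord p i - coord q i"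
  using index_one by (simp add: coord_def poly_at_mats_diff)

lemma coord_scaleQ: "i < k \<Longrightarrow> coord (scaleQ c p) i = c * coord p i"
  using index_one by (simp add: coord_def poly_at_mats_scaleQ)

lemma coord_sum: "i < k \<Longrightarrow> coord (sum p S) i = (\<Sum>x\<in>S. coord (p x) i)"
  using index_one by (simp add: coord_def poly_at_mats_sum_index)

text \<open>As evaluation is multiplicative, \<open>p(X)\<close> acts on coordinate vectors as
  multiplication by \<open>p\<close>.\<close>

lemma coord_mult:
  assumes "i < k"
  shows "coord (p * q) i = (\<Sum>l<k. poly_at_mats k p X $$ (i, l) * coord q l)"
  using assms index_one
  by (simp add: coord_def poly_at_mats_mult scalar_prod_def lessThan_atLeast0)

text \<open>Connectedness writes \<open>b\<close> as \<open>x_s b'\<close> with \<open>b'\<close> in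
  the set and of smaller degree. By induction \<open>b'\<close> has a unit vector as coordinates, so
  those of \<open>b\<close> are a column of \<open>X s\<close>, which \<open>col_X\<close>
  determines.\<close>

lemma coord_basis:
  assumes "b \<in> set bs" and "i < k" and "j < k" and "b = bs ! j"
  shows "coord (monom_poly b) i = (if i = j then 1 else 0)"
  using assms
proof (induction "mono_deg b" arbitrary: b i j rule: less_induct)
  case less
  show ?case
  proof (cases "b = 0")
    case True
    then have "j = index_one"
      using less.prems index_one distinct by (metis length nth_eq_iff_index_eq)
    then show ?thesis
      using True less.prems index_one by (simp add: coord_def poly_at_mats_monom mono_at_mats_0)
  next
    case False
    obtain s b' where b': "b' \<in> set bs" and b: "b = var s + b'"
      using connected_to_one_predecessor[OF connected less.prems(1) False] .
    obtain j' where j': "j' < k" "bs ! j' = b'"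
      using index_basis[OF b'] .
    have "monom_poly b = monom_poly (var s) * monom_poly b'"
      by (simp add: b monom_poly_def mult_single)
    then have "coord (monom_poly b) i = (\<Sum>l<k. X s $$ (i, l) * coord (monom_poly b') l)"
      using less.prems by (simp add: coord_mult poly_at_mats_monom mono_at_mats_var)
    also have "\<dots> = (\<Sum>l<k. if l = j' then X s $$ (i, l) else 0)"
      using j' b' by (intro sum.cong refl) (simp add: less.hyps mono_deg_var_add b)
    also have "\<dots> = col (X s) j' $ i"
      using j' less.prems by (simp add: index_col carrier_matD[OF X_carrier])
    also have "\<dots> = (if i = j then 1 else 0)"
      using col_X[of j' j s] j' less.prems b by simp
    finally show ?thesis .
  qed
qed

lemma coord_nth: "i < k \<Longrightarrow> j < k \<Longrightarrow> coord (monom_poly (bs ! j)) i = (if i = j then 1 else 0)"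
  using coord_basis basis_in_set by blast

lemma coord_mult_basis:
  assumes "i < k" and "j < k"
  shows "coord (p * monom_poly (bs ! j)) i = poly_at_mats k p X $$ (i, j)"
  using assms by (simp add: coord_mult coord_nth if_distrib[of "\<lambda>x. _ * x"] cong: if_cong)

text \<open>The column of 1 determines the whole matrix: as polynomials commute, column
  \<open>j\<close> of \<open>p(X)\<close> is the value of the \<open>j\<close>-th monomial at
  \<open>X\<close> applied to the coordinates of \<open>p\<close>.\<close>

lemma vanishing_iff_coord: "p \<in> vanishing \<longleftrightarrow> (\<forall>i<k. coord p i = 0)"
proof
  assume "p \<in> vanishing"
  then show "\<forall>i<k. coord p i = 0"
    using index_one by (simp add: vanishing_def coord_def)
next
  assume *: "\<forall>i<k. coord p i = 0"
  have "poly_at_mats k p X $$ (i, j) = 0" if "i < k" "j < k" for i j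
  proof -
    have "poly_at_mats k p X $$ (i, j) = coord (monom_poly (bs ! j) * p) i"
      using that by (simp add: coord_mult_basis mult.commute)
    also have "\<dots> = 0"
      using that * by (simp add: coord_mult)
    finally show ?thesis .
  qed
  then show "p \<in> vanishing"
    by (auto simp: vanishing_def intro!: eq_matI)
qed

lemma coord_basis_comb:
  assumes "i < k"
  shows "coord (\<Sum>j<k. scaleQ (u j) (monom_poly (bs ! j))) i = u i"
  using assms by (simp add: coord_sum coord_scaleQ coord_nth if_distrib[of "\<lambda>x. _ * x"] cong: if_cong)

lemma minus_coord_comb_vanishing:
  "p - (\<Sum>j<k. scaleQ (coord p j) (monom_poly (bs ! j))) \<in> vanishing"
  by (simp add: vanishing_iff_coord coord_diff coord_basis_comb)

section \<open>The monomial basis and the trace modulo the kernel\<close>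

lemma sum_basis_reindex: "(\<Sum>b\<in>monom_poly ` set bs. F b) = (\<Sum>j<k. F (monom_poly (bs ! j)))"
proof -
  have "inj (monom_poly :: 'n monomial \<Rightarrow> 'n qpoly)"
    by (rule injI) (metis monom_poly_def lookup_single_eq lookup_single_not_eq zero_neq_one)
  moreover have "inj_on ((!) bs) {..<k}"
    using distinct by (auto simp: inj_on_def length nth_eq_iff_index_eq)
  ultimately have "inj_on (\<lambda>j. monom_poly (bs ! j) :: 'n qpoly) {..<k}"
    by (simp add: inj_on_def)
  moreover have "monom_poly ` set bs = (\<lambda>j. monom_poly (bs ! j) :: 'n qpoly) ` {..<k}"
    by (auto simp: set_conv_nth length)
  ultimately show ?thesis
    by (simp add: sum.reindex)
qed

text \<open>Coordinates identify the quotient with the rational vectors of length \<open>k\<close>,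
  the monomials corresponding to the unit vectors.\<close>

lemma quot_basis_vanishing: "quot_basis vanishing (monom_poly ` set bs)"
  unfolding quot_basis_def
proof (intro conjI allI impI)
  show "finite (monom_poly ` set bs)" by simp
next
  fix u assume "(\<Sum>b\<in>monom_poly ` set bs. scaleQ (u b) b) \<in> vanishing"
  then have "\<forall>i<k. u (monom_poly (bs ! i)) = 0"
    by (simp add: sum_basis_reindex vanishing_iff_coord coord_basis_comb)
  then show "\<forall>b\<in>monom_poly ` set bs. u b = 0"
    using length by (auto simp: set_conv_nth)
next
  fix p
  \<comment> \<open>Coefficients have to be indexed by polynomials, not positions. The choice
    recovers the position, which is unique because different basis monomials have different
    coordinates.\<close>
  define u where "u = (\<lambda>b. coord p (SOME i. i < k \<and> monom_poly (bs ! i) = b))"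
  have "u (monom_poly (bs ! j)) = coord p j" if "j < k" for j
  proof -
    have "i = j" if "i < k" and eq: "monom_poly (bs ! i) = (monom_poly (bs ! j) :: 'n qpoly)" for i
      using coord_nth[OF \<open>j < k\<close> \<open>j < k\<close>] coord_nth[OF \<open>j < k\<close> \<open>i < k\<close>] unfolding eq
      by (auto split: if_splits)
    then have "(SOME i. i < k \<and> monom_poly (bs ! i) = (monom_poly (bs ! j) :: 'n qpoly)) = j"
      using that by (intro some_equality) auto
    then show ?thesis by (simp add: u_def)
  qed
  then show "\<exists>u. p - (\<Sum>b\<in>monom_poly ` set bs. scaleQ (u b) b) \<in> vanishing"
    using minus_coord_comb_vanishing[of p] by (intro exI[of _ u]) (simp add: sum_basis_reindex)
qed

text \<open>Since \<open>trace_mult\<close> refers to some chosen basis \<open>C\<close>, what has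
  to be shown is the invariance of the trace under the change from \<open>C\<close> to
  \<open>bs\<close>.\<close>

lemma trace_mult_vanishing: "trace_mult vanishing h = mat_trace (poly_at_mats k h X)"
proof -
  define C where "C = (SOME C. quot_basis vanishing C)"
  have "quot_basis vanishing C"
    unfolding C_def by (rule someI, rule quot_basis_vanishing)
  then have indep: "\<And>u b. (\<Sum>b\<in>C. scaleQ (u b) b) \<in> vanishing \<Longrightarrow> b \<in> C \<Longrightarrow> u b = 0"
    and spanning: "\<And>p. \<exists>u. p - (\<Sum>b\<in>C. scaleQ (u b) b) \<in> vanishing"
    unfolding quot_basis_def by blast+
  define w where "w = quot_coords vanishing C"
  have w: "p - (\<Sum>b\<in>C. scaleQ (w p b) b) \<in> vanishing" for p
    unfolding w_def quot_coords_def by (rule someI_ex[OF spanning])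
  have coord_w: "coord p i = (\<Sum>b\<in>C. w p b * coord b i)" if "i < k" for p i
    using w[of p] that by (simp add: vanishing_iff_coord coord_diff coord_sum coord_scaleQ)
  \<comment> \<open>Column \<open>j\<close> of \<open>R\<close> expresses the \<open>j\<close>-th
    monomial in \<open>C\<close>, while \<open>coord b\<close> expresses \<open>b\<close> in the
    monomials; the next fact says that composing the two changes gives the identity.\<close>
  define R where "R b j = w (monom_poly (bs ! j)) b" for b j
  have R: "(\<Sum>b\<in>C. R b j * coord b i) = (if i = j then 1 else 0)" if "i < k" "j < k" for i j
    using coord_w[of i "monom_poly (bs ! j)"] that by (simp add: R_def coord_nth)
  \<comment> \<open>As \<open>C\<close> is independent modulo the kernel, it suffices that both
    families of coefficients yield the same coordinates.\<close>
  have w_R: "w p b = (\<Sum>j<k. coord p j * R b j)" if "b \<in> C" for p b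
  proof -
    have "(\<Sum>b\<in>C. (w p b - (\<Sum>j<k. coord p j * R b j)) * coord b i) = 0" if "i < k" for i
    proof -
      have "(\<Sum>b\<in>C. (\<Sum>j<k. coord p j * R b j) * coord b i)
          = (\<Sum>j<k. coord p j * (\<Sum>b\<in>C. R b j * coord b i))"
        by (subst sum_distrib_right, subst sum.swap) (simp add: sum_distrib_left mult.assoc)
      also have "\<dots> = coord p i"
        using that by (simp add: R if_distrib[of "\<lambda>x. _ * x"] cong: if_cong)
      finally show ?thesis
        using coord_w[OF that, of p] by (simp add: left_diff_distrib sum_subtractf)
    qed
    then have "(\<Sum>b\<in>C. scaleQ (w p b - (\<Sum>j<k. coord p j * R b j)) b) \<in> vanishing"
      by (simp add: vanishing_iff_coord coord_sum coord_scaleQ)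
    from indep[OF this that] show ?thesis by simp
  qed
  have "trace_mult vanishing h = (\<Sum>b\<in>C. w (h * b) b)"
    by (simp add: trace_mult_def C_def w_def Let_def)
  also have "\<dots> = (\<Sum>b\<in>C. \<Sum>j<k. (\<Sum>l<k. poly_at_mats k h X $$ (j, l) * coord b l) * R b j)"
    by (simp add: w_R coord_mult)
  \<comment> \<open>This reordering is the cyclicity of the trace: it brings the two changes of
    basis together, so that they cancel.\<close>
  also have "\<dots> = (\<Sum>j<k. \<Sum>l<k. \<Sum>b\<in>C. poly_at_mats k h X $$ (j, l) * (R b j * coord b l))"
    by (subst sum.swap, rule sum.cong[OF refl])
      (subst sum.swap, simp add: sum_distrib_left mult_ac)
  also have "\<dots> = (\<Sum>j<k. \<Sum>l<k. poly_at_mats k h X $$ (j, l) * (if l = j then 1 else 0))"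
    by (simp add: R flip: sum_distrib_left)
  also have "\<dots> = mat_trace (poly_at_mats k h X)"
    by (simp add: mat_trace_def if_distrib[of "\<lambda>x. _ * x"] cong: if_cong)
  finally show ?thesis .
qed

section \<open>The kernel as an ideal, and comparison by dimension\<close>

lemma vanishing_add: "p \<in> vanishing \<Longrightarrow> q \<in> vanishing \<Longrightarrow> p + q \<in> vanishing"
  by (simp add: vanishing_iff_coord coord_add)

lemma vanishing_mult: "q \<in> vanishing \<Longrightarrow> p * q \<in> vanishing"
  by (simp add: vanishing_iff_coord coord_mult)

lemma ideal_gen_subset_vanishing:
  assumes "\<And>p. p \<in> set f \<Longrightarrow> poly_at_mats k p X = 0\<^sub>m k k"
  shows "ideal_gen f \<subseteq> vanishing"
proof
  interpret Modules.module "(*) :: 'n qpoly \<Rightarrow> 'n qpoly \<Rightarrow> 'n qpoly"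
    by (rule module_qpoly)
  fix p assume "p \<in> ideal_gen f"
  then have "p \<in> span (set f)"
    by (simp add: ideal_gen_def)
  then show "p \<in> vanishing"
  proof (induction p rule: span_induct_alt)
    case base
    show ?case by (simp add: vanishing_def poly_at_mats_0)
  next
    case (step c x y)
    then have "x \<in> vanishing"
      using assms by (simp add: vanishing_def)
    then show ?case
      using step by (intro vanishing_add vanishing_mult)
  qed
qed

text \<open>
  Coordinates with respect to \<open>C\<close> and to \<open>bs\<close> give matrices \<open>P\<close>, \<open>R\<close> with \<open>P R = 1\<close>; they are
  square after padding with zeros, so that \<open>R P = 1\<close> on the first \<open>card C\<close> coordinates.
\<close>

lemma vanishing_eqI:
  assumes basis: "quot_basis K C" and sub: "K \<subseteq> vanishing" and card: "card C \<le> k"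
    and add: "\<And>p q. p \<in> K \<Longrightarrow> q \<in> K \<Longrightarrow> p + q \<in> K"
  shows "K = vanishing"
proof
  show "vanishing \<subseteq> K"
  proof
    fix p assume p: "p \<in> vanishing"
    have fin: "finite C" and spanning: "\<And>p. \<exists>u. p - (\<Sum>b\<in>C. scaleQ (u b) b) \<in> K"
      using basis unfolding quot_basis_def by blast+
    define w where "w = quot_coords K C"
    have w: "p - (\<Sum>b\<in>C. scaleQ (w p b) b) \<in> K" for p
      unfolding w_def quot_coords_def by (rule someI_ex[OF spanning])
    have coord_w: "coord p i = (\<Sum>b\<in>C. w p b * coord b i)" if "i < k" for p i
      using w[of p] sub that by (auto simp: vanishing_iff_coord coord_diff coord_sum coord_scaleQ)
    obtain cs where cs: "set cs = C" "distinct cs"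
      using finite_distinct_list[OF fin] by blast
    define m where "m = length cs"
    have m: "m \<le> k"
      using card cs by (metis m_def distinct_card)
    have bij: "bij_betw ((!) cs) {..<m} C"
      using cs by (simp add: m_def bij_betw_nth)
    have C_sum: "(\<Sum>b\<in>C. F b) = (\<Sum>l<m. F (cs ! l))" for F :: "'n qpoly \<Rightarrow> rat"
      using sum.reindex_bij_betw[OF bij, of F] by simp
    have pad: "(\<Sum>l<k. if l < m then F l else 0) = (\<Sum>l<m. F l)" for F :: "nat \<Rightarrow> rat"
      using m by (intro sum.mono_neutral_cong_right) auto
    define P where "P = mat k k (\<lambda>(i, l). if l < m then coord (cs ! l) i else 0)"
    define R where "R = mat k k (\<lambda>(l, j). if l < m then w (monom_poly (bs ! j)) (cs ! l) else 0)"
    have P: "P \<in> carrier_mat k k" and R: "R \<in> carrier_mat k k"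
      by (simp_all add: P_def R_def)
    have "P * R = 1\<^sub>m k"
    proof (rule eq_matI)
      fix i j assume "i < dim_row (1\<^sub>m k :: rat mat)" "j < dim_col (1\<^sub>m k :: rat mat)"
      then have ij: "i < k" "j < k" by auto
      have "(P * R) $$ (i, j)
          = (\<Sum>l<k. if l < m then w (monom_poly (bs ! j)) (cs ! l) * coord (cs ! l) i else 0)"
        using ij by (auto simp: P_def R_def scalar_prod_def lessThan_atLeast0 intro!: sum.cong)
      also have "\<dots> = coord (monom_poly (bs ! j)) i"
        using ij by (simp add: pad coord_w[of i "monom_poly (bs ! j)"] C_sum)
      finally show "(P * R) $$ (i, j) = (1\<^sub>m k :: rat mat) $$ (i, j)"
        using ij by (simp add: coord_nth)
    qed (simp_all add: P_def R_def)
    then have RP: "R * P = 1\<^sub>m k"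
      by (rule mat_mult_left_right_inverse[OF P R])
    \<comment> \<open>The padded coefficients of \<open>p\<close> with respect to \<open>C\<close>.
      Their image under \<open>P\<close> is the coordinate vector of \<open>p\<close>, hence zero,
      and \<open>R\<close> undoes \<open>P\<close>.\<close>
    define v where "v = vec k (\<lambda>l. if l < m then w p (cs ! l) else 0)"
    have v: "v \<in> carrier_vec k" by (simp add: v_def)
    have "P *\<^sub>v v = 0\<^sub>v k"
    proof (rule eq_vecI)
      fix i assume "i < dim_vec (0\<^sub>v k :: rat vec)"
      then have i: "i < k" by simp
      have "(P *\<^sub>v v) $ i = (\<Sum>l<k. if l < m then w p (cs ! l) * coord (cs ! l) i else 0)"
        using i by (auto simp: P_def v_def scalar_prod_def lessThan_atLeast0 intro!: sum.cong)
      also have "\<dots> = coord p i"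
        using i by (simp add: pad coord_w[of i p] C_sum)
      finally show "(P *\<^sub>v v) $ i = (0\<^sub>v k :: rat vec) $ i"
        using i p by (simp add: vanishing_iff_coord)
    qed (simp add: P_def)
    moreover have "v = R *\<^sub>v (P *\<^sub>v v)"
      using assoc_mult_mat_vec[OF R P v] v by (simp add: RP)
    moreover have "R *\<^sub>v 0\<^sub>v k = 0\<^sub>v k"
      using R by (intro eq_vecI) auto
    ultimately have "v = 0\<^sub>v k"
      by simp
    then have "v $ l = 0" if "l < m" for l
      using that m by simp
    then have "w p (cs ! l) = 0" if "l < m" for l
      using that m by (simp add: v_def)
    then have "w p b = 0" if "b \<in> C" for b
      using that bij by (metis bij_betw_imp_surj_on imageE lessThan_iff)
    then have "(\<Sum>b\<in>C. scaleQ (w p b) b) = 0"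
      by (simp add: scaleQ_def const_def)
    then show "p \<in> K"
      using w[of p] by simp
  qed
qed (rule sub)

section \<open>The trace form and radicality of the kernel\<close>

lemma mat_trace_monom_mult:
  "mat_trace (poly_at_mats k (monom_poly a * p) X) =
    (\<Sum>i<k. mat_trace (mono_at_mats k (a + bs ! i) X) * coord p i)"
proof -
  \<comment> \<open>The representative of \<open>p\<close> in the span of the basis monomials.
    Multiplying the difference \<open>p - r\<close> by a monomial stays in the kernel, so
    \<open>r\<close> may replace \<open>p\<close> under the trace.\<close>
  define r where "r = (\<Sum>i<k. scaleQ (coord p i) (monom_poly (bs ! i)))"
  have "monom_poly a * (p - r) \<in> vanishing"
    using minus_coord_comb_vanishing[of p] by (simp add: r_def vanishing_mult)
  then have "poly_at_mats k (monom_poly a * p) X - poly_at_mats k (monom_poly a * r) X = 0\<^sub>m k k"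
    by (simp add: vanishing_def right_diff_distrib poly_at_mats_diff)
  then have "poly_at_mats k (monom_poly a * p) X $$ (j, j) = poly_at_mats k (monom_poly a * r) X $$ (j, j)"
    if "j < k" for j
    using that by (metis index_minus_mat(1) index_zero_mat(1) poly_at_mats_dim right_minus_eq)
  then have "mat_trace (poly_at_mats k (monom_poly a * p) X) = mat_trace (poly_at_mats k (monom_poly a * r) X)"
    by (simp add: mat_trace_def)
  also have "monom_poly a * r = (\<Sum>i<k. scaleQ (coord p i) (monom_poly (a + bs ! i)))"
    by (simp add: r_def sum_distrib_left scaleQ_def const_def monom_poly_def mult_single)
  also have "mat_trace (poly_at_mats k \<dots> X) =
      (\<Sum>j<k. \<Sum>i<k. coord p i * mono_at_mats k (a + bs ! i) X $$ (j, j))"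
    by (simp add: mat_trace_def poly_at_mats_sum_index poly_at_mats_scaleQ poly_at_mats_monom
        carrier_matD[OF mono_at_mats_carrier])
  also have "\<dots> = (\<Sum>i<k. mat_trace (mono_at_mats k (a + bs ! i) X) * coord p i)"
    by (subst sum.swap) (simp add: mat_trace_def carrier_matD[OF mono_at_mats_carrier]
        sum_distrib_left mult.commute)
  finally show ?thesis .
qed

text \<open>The Gram matrix, in the basis \<open>bs\<close>, of the bilinear form sending
  \<open>p\<close> and \<open>q\<close> to the trace of \<open>(p q)(X)\<close>.\<close>

definition trace_form :: "rat mat" where
  "trace_form = mat k k (\<lambda>(i, j). mat_trace (mono_at_mats k (bs ! i + bs ! j) X))"

lemma trace_form_carrier: "trace_form \<in> carrier_mat k k"
  by (simp add: trace_form_def)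

text \<open>The coordinate vector of \<open>q\<close> lies in the kernel of
  \<open>trace_form\<close>, because its product with row \<open>i\<close> is the trace of a matrix
  of square zero.\<close>

lemma vanishing_if_square_vanishing:
  assumes det: "det trace_form \<noteq> 0" and sq: "q * q \<in> vanishing"
  shows "q \<in> vanishing"
proof -
  define c where "c = vec k (coord q)"
  have "trace_form *\<^sub>v c = 0\<^sub>v k"
  proof (rule eq_vecI)
    fix i assume "i < dim_vec (0\<^sub>v k :: rat vec)"
    then have i: "i < k" by simp
    let ?p = "monom_poly (bs ! i) * q"
    have "(trace_form *\<^sub>v c) $ i = mat_trace (poly_at_mats k ?p X)"
      using i by (simp add: trace_form_def c_def scalar_prod_def mat_trace_monom_mult lessThan_atLeast0)
    also have "\<dots> = 0"
    proof (rule mat_trace_square_zero)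
      have "(monom_poly (bs ! i) * monom_poly (bs ! i)) * (q * q) \<in> vanishing"
        using sq by (rule vanishing_mult)
      then show "poly_at_mats k ?p X * poly_at_mats k ?p X = 0\<^sub>m k k"
        by (simp add: vanishing_def mult_ac flip: poly_at_mats_mult)
    qed (rule poly_at_mats_carrier)
    finally show "(trace_form *\<^sub>v c) $ i = (0\<^sub>v k :: rat vec) $ i"
      using i by simp
  qed (simp add: trace_form_def)
  then have "c = 0\<^sub>v k"
    using det det_0_iff_vec_prod_zero_field[OF trace_form_carrier] vec_carrier[of k "coord q"]
    unfolding c_def by blast
  then show ?thesis
    by (auto simp: vanishing_iff_coord c_def vec_eq_iff)
qed

lemma radical_subset_vanishing:
  assumes det: "det trace_form \<noteq> 0" and sub: "K \<subseteq> vanishing"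
  shows "radical K \<subseteq> vanishing"
proof
  fix p assume "p \<in> radical K"
  then obtain e where "e > 0" and "p ^ e \<in> vanishing"
    using sub by (auto simp: radical_def)
  then show "p \<in> vanishing"
  proof (induction e rule: less_induct)
    case (less e)
    show ?case
    proof (cases "e = 1")
      case True
      then show ?thesis using less.prems by simp
    next
      case False
      \<comment> \<open>Half of \<open>e\<close>, rounded up: \<open>2 * d\<close> is at least
        \<open>e\<close>, so \<open>p ^ (2 * d)\<close> stays in the kernel, and \<open>d\<close> is
        below \<open>e\<close> because \<open>e\<close> is at least 2.\<close>
      define d where "d = (e + 1) div 2"
      have "2 * d = e \<or> 2 * d = e + 1" and d: "0 < d" "d < e"
        using less.prems False by (auto simp: d_def)
      then have "p ^ (2 * d) = p ^ (2 * d - e) * p ^ e"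
        by (auto simp flip: power_add)
      then have "p ^ d * p ^ d \<in> vanishing"
        using vanishing_mult[OF less.prems(2), of "p ^ (2 * d - e)"] by (simp add: mult_2 power_add)
      then have "p ^ d \<in> vanishing"
        by (rule vanishing_if_square_vanishing[OF det])
      then show ?thesis
        using less.IH d by blast
    qed
  qed
qed

end


section \<open>Quotients by radicals\<close>

lemma ideal_gen_add: "p \<in> ideal_gen f \<Longrightarrow> q \<in> ideal_gen f \<Longrightarrow> p + q \<in> ideal_gen f"
proof -
  interpret Modules.module "(*) :: 'a qpoly \<Rightarrow> 'a qpoly \<Rightarrow> 'a qpoly"
    by (rule module_qpoly)
  show "p \<in> ideal_gen f \<Longrightarrow> q \<in> ideal_gen f \<Longrightarrow> p + q \<in> ideal_gen f"
    unfolding ideal_gen_def by (rule span_add)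
qed

lemma ideal_gen_mult: "q \<in> ideal_gen f \<Longrightarrow> p * q \<in> ideal_gen f"
proof -
  interpret Modules.module "(*) :: 'a qpoly \<Rightarrow> 'a qpoly \<Rightarrow> 'a qpoly"
    by (rule module_qpoly)
  show "q \<in> ideal_gen f \<Longrightarrow> p * q \<in> ideal_gen f"
    unfolding ideal_gen_def by (rule span_scale)
qed

lemma ideal_gen_0: "0 \<in> ideal_gen f"
proof -
  interpret Modules.module "(*) :: 'a qpoly \<Rightarrow> 'a qpoly \<Rightarrow> 'a qpoly"
    by (rule module_qpoly)
  show ?thesis
    unfolding ideal_gen_def by (rule span_zero)
qed

lemma ideal_gen_subset_radical: "ideal_gen f \<subseteq> radical (ideal_gen f)"
  by (auto simp: radical_def intro!: exI[of _ 1])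

lemma radical_ideal_gen_mult:
  assumes "q \<in> radical (ideal_gen f)"
  shows "p * q \<in> radical (ideal_gen f)"
  using assms by (auto simp: radical_def power_mult_distrib intro: ideal_gen_mult)

text \<open>In each term of the binomial expansion of \<open>(p + q) ^ (a + b)\<close>, either the
  exponent of \<open>p\<close> is at least \<open>a\<close> or that of \<open>q\<close> is at least
  \<open>b\<close>.\<close>

lemma radical_ideal_gen_add:
  assumes "p \<in> radical (ideal_gen f)" and "q \<in> radical (ideal_gen f)"
  shows "p + q \<in> radical (ideal_gen f)"
proof -
  obtain a b where a: "a > 0" "p ^ a \<in> ideal_gen f" and b: "b > 0" "q ^ b \<in> ideal_gen f"
    using assms by (auto simp: radical_def)
  have "of_nat (a + b choose i) * p ^ i * q ^ (a + b - i) \<in> ideal_gen f" for i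
  proof (cases "a \<le> i")
    case True
    then have "p ^ i = p ^ (i - a) * p ^ a"
      by (simp flip: power_add)
    then have "of_nat (a + b choose i) * p ^ i * q ^ (a + b - i)
        = (of_nat (a + b choose i) * q ^ (a + b - i) * p ^ (i - a)) * p ^ a"
      by (simp add: mult_ac)
    then show ?thesis
      using ideal_gen_mult[OF a(2)] by simp
  next
    case False
    then have "q ^ (a + b - i) = q ^ (a - i) * q ^ b"
      by (simp flip: power_add)
    then have "of_nat (a + b choose i) * p ^ i * q ^ (a + b - i)
        = (of_nat (a + b choose i) * p ^ i * q ^ (a - i)) * q ^ b"
      by (simp add: mult_ac)
    then show ?thesis
      using ideal_gen_mult[OF b(2)] by simp
  qed
  then have "(\<Sum>i\<in>S. of_nat (a + b choose i) * p ^ i * q ^ (a + b - i)) \<in> ideal_gen f" for S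
    by (induction S rule: infinite_finite_induct) (auto simp: ideal_gen_0 intro: ideal_gen_add)
  then have "(p + q) ^ (a + b) \<in> ideal_gen f"
    by (simp add: binomial_ring)
  then show ?thesis
    using a by (auto simp: radical_def)
qed

text \<open>A spanning set of least cardinality is independent: a nontrivial relation would allow
  one of its elements to be dropped.\<close>

lemma quot_basis_if_finite_spanning:
  fixes K :: "'n qpoly set"
  assumes add: "\<And>p q. p \<in> K \<Longrightarrow> q \<in> K \<Longrightarrow> p + q \<in> K"
    and mult: "\<And>p q. q \<in> K \<Longrightarrow> p * q \<in> K"
    and fin: "finite C0" and spanning: "\<And>p. \<exists>u. p - (\<Sum>b\<in>C0. scaleQ (u b) b) \<in> K"
  shows "\<exists>C. quot_basis K C"
proof -
  interpret vector_space scaleQ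
    by (rule vector_space_scaleQ)
  let ?S = "\<lambda>C. finite C \<and> (\<forall>p. \<exists>u. p - (\<Sum>b\<in>C. scaleQ (u b) b) \<in> K)"
  obtain C where C: "?S C" and minimal: "\<And>D. ?S D \<Longrightarrow> card C \<le> card D"
    using ex_has_least_nat[of ?S C0 card] fin spanning by blast
  have "u b0 = 0" if u: "(\<Sum>b\<in>C. scaleQ (u b) b) \<in> K" and b0: "b0 \<in> C" for u b0
  proof (rule ccontr)
    assume nz: "u b0 \<noteq> 0"
    have "\<exists>v. p - (\<Sum>b\<in>C - {b0}. scaleQ (v b) b) \<in> K" for p
    proof -
      obtain w where w: "p - (\<Sum>b\<in>C. scaleQ (w b) b) \<in> K"
        using C by blast
      \<comment> \<open>Subtracting \<open>r\<close> times the relation makes the coefficient of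
        \<open>b0\<close> zero.\<close>
      define r where "r = w b0 / u b0"
      have "(\<Sum>b\<in>C - {b0}. scaleQ (w b - r * u b) b) = (\<Sum>b\<in>C. scaleQ (w b - r * u b) b)"
        using C b0 nz by (intro sum.mono_neutral_left) (auto simp: r_def)
      also have "\<dots> = (\<Sum>b\<in>C. scaleQ (w b) b) - scaleQ r (\<Sum>b\<in>C. scaleQ (u b) b)"
        by (simp add: scale_left_diff_distrib sum_subtractf scale_sum_right)
      finally have "p - (\<Sum>b\<in>C - {b0}. scaleQ (w b - r * u b) b)
          = (p - (\<Sum>b\<in>C. scaleQ (w b) b)) + scaleQ r (\<Sum>b\<in>C. scaleQ (u b) b)"
        by simp
      also have "\<dots> \<in> K"
        unfolding scaleQ_def[of r] by (rule add[OF w mult[OF u]])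
      finally show ?thesis
        by (intro exI)
    qed
    then have "card C \<le> card (C - {b0})"
      using C by (intro minimal) auto
    then show False
      using C b0 by (metis card_Diff1_less not_le)
  qed
  then have "quot_basis K C"
    using C unfolding quot_basis_def by blast
  then show ?thesis ..
qed

text \<open>A basis modulo the ideal still spans modulo the larger radical, where it may become
  dependent.\<close>

lemma quot_basis_radical_exists:
  assumes "zero_dimensional (ideal_gen f)"
  shows "\<exists>C. quot_basis (radical (ideal_gen f)) C"
proof -
  obtain C where "finite C" and "\<And>p. \<exists>u. p - (\<Sum>b\<in>C. scaleQ (u b) b) \<in> ideal_gen f"
    using assms unfolding zero_dimensional_def quot_basis_def by blast
  then show ?thesis
    using ideal_gen_subset_radical[of f]
    by (intro quot_basis_if_finite_spanning[of _ C] radical_ideal_gen_add radical_ideal_gen_mult) blast+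
qed

section \<open>The certified matrices as Hermite matrices of the radical\<close>

theorem theorem5p3:
  fixes f :: "'n::{finite,linorder} qpoly list" and g :: "'n qpoly"
    and B Bbar :: "'n monomial set" and k l kbar :: nat
    and E M :: real and z :: "nat \<Rightarrow> 'n \<Rightarrow> complex"
    and Hbar :: "'n monomial \<Rightarrow> 'n monomial \<Rightarrow> rat"
    and bs :: "'n monomial list" and H1 Hg :: "rat mat"
  assumes "zero_dimensional (ideal_gen f)"
    and "connected_to_one B" and "card B = k" and "card (extension B) = l"
    and "E > 0" and "M > 0"
    and "\<forall>s<k. inf_norm (z s) \<le> M - E"
    and "\<forall>s<k. \<exists>\<xi>. (\<forall>p \<in> set f. poly_at p \<xi> = 0) \<and> inf_norm (\<lambda>i. z s i - \<xi> i) \<le> E"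
    and "hermite_computation_returns k B E M z kbar Bbar Hbar"
    and "kbar \<le> k" and "Bbar \<subseteq> B" and "connected_to_one Bbar" and "card Bbar = kbar"
    and "kbar \<ge> quot_dim (radical (ideal_gen f))"
    and "distinct bs" and "set bs = Bbar"
    and "hermite_certification_returns f g bs Hbar H1 Hg"
  shows "quot_basis (radical (ideal_gen f)) (monom_poly ` Bbar) \<and>
         H1 = hermite_matrix (radical (ideal_gen f)) bs 1 \<and>
         Hg = hermite_matrix (radical (ideal_gen f)) bs g"
proof -
  have len: "length bs = kbar"
    using distinct_card[OF assms(15)] assms(13,16) by simp
  define X where "X = (\<lambda>s. the (mat_inverse H1) * submat bs (map (\<lambda>b. var s + b) bs) Hbar)"
  have X: "the (mat_inverse H1) * submat bs (map (\<lambda>b. var s + b) bs) Hbar = X s" for s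
    by (simp add: X_def)
  note certified = assms(17)[unfolded hermite_certification_returns_def Let_def len X]
  have H1: "H1 = submat bs bs Hbar" and rank: "vec_space.rank kbar H1 = kbar"
    and col: "\<And>s i j. i < kbar \<Longrightarrow> j < kbar \<Longrightarrow> var s + bs ! i = bs ! j \<Longrightarrow> col (X s) i = unit_vec kbar j"
    and comm: "\<And>s t. s < t \<Longrightarrow> X s * X t = X t * X s"
    and f0: "\<And>p. p \<in> set f \<Longrightarrow> poly_at_mats kbar p X = 0\<^sub>m kbar kbar"
    and trace: "\<And>i j. i < kbar \<Longrightarrow> j < kbar \<Longrightarrow>
      mat_trace (mono_at_mats kbar (bs ! i + bs ! j) X) = H1 $$ (i, j)"
    and Hg: "Hg = H1 * poly_at_mats kbar g X"
    using certified by blast+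
  have H1_carrier: "H1 \<in> carrier_mat kbar kbar"
    by (simp add: H1 submat_def len)
  \<comment> \<open>Non-singularity serves twice: it makes the inverse in \<open>X\<close>
    meaningful, and it makes the trace form nondegenerate.\<close>
  have det: "det H1 \<noteq> 0"
    using vec_space.det_rank_iff[OF H1_carrier] rank by blast
  then have "H1 \<in> Units (ring_mat TYPE(rat) kbar ())"
    by (rule det_non_zero_imp_unit[OF H1_carrier])
  then obtain Y where Y: "mat_inverse H1 = Some Y"
    using mat_inverse(1)[OF H1_carrier, where b = "()"] by (cases "mat_inverse H1") auto
  have X_carrier: "X s \<in> carrier_mat kbar kbar" for s
    using mat_inverse(2)[OF H1_carrier Y] by (auto simp: X_def Y submat_def len)
  interpret multiplication_matrices kbar X bs
  proof
    show "X s * X t = X t * X s" for s t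
      using comm by (metis linorder_less_linear)
    show "connected_to_one (set bs)"
      using assms(12,16) by simp
  qed (use X_carrier col assms(15) len in auto)
  have form: "trace_form = H1"
    using H1_carrier by (intro eq_matI) (auto simp: trace_form_def trace)
  let ?I = "radical (ideal_gen f)"
  have "?I \<subseteq> vanishing"
    using det f0 by (intro radical_subset_vanishing ideal_gen_subset_vanishing) (auto simp: form)
  \<comment> \<open>This chosen set is the one whose cardinality is \<open>quot_dim\<close>; as it
    is a basis, the bound on \<open>kbar\<close> allows the comparison of dimensions.\<close>
  moreover have "quot_basis ?I (SOME C. quot_basis ?I C)"
    using quot_basis_radical_exists[OF assms(1)] by (rule someI_ex)
  ultimately have I: "?I = vanishing"
    using assms(14) radical_ideal_gen_add unfolding quot_dim_def by (intro vanishing_eqI) auto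
  have "H1 = hermite_matrix ?I bs 1"
    using H1_carrier
    by (intro eq_matI) (auto simp: hermite_matrix_def I trace_mult_vanishing poly_at_mats_monom trace len)
  moreover have "Hg = hermite_matrix ?I bs g"
  proof (rule eq_matI)
    fix i j assume "i < dim_row (hermite_matrix ?I bs g)" "j < dim_col (hermite_matrix ?I bs g)"
    then have ij: "i < kbar" "j < kbar"
      by (simp_all add: hermite_matrix_def len)
    have "hermite_matrix ?I bs g $$ (i, j) =
        mat_trace (poly_at_mats kbar (g * monom_poly (bs ! i + bs ! j)) X)"
      using ij by (simp add: hermite_matrix_def I trace_mult_vanishing len)
    \<comment> \<open>With this grouping the trace becomes row \<open>i\<close> of \<open>H1\<close>
      times the coordinates of \<open>g\<close> times the \<open>j\<close>-th monomial, and these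
      are column \<open>j\<close> of \<open>g(X)\<close>.\<close>
    also have "g * monom_poly (bs ! i + bs ! j) = monom_poly (bs ! i) * (g * monom_poly (bs ! j))"
      by (simp add: monom_poly_def mult.left_commute mult_single)
    also have "mat_trace (poly_at_mats kbar \<dots> X) =
        (\<Sum>m<kbar. H1 $$ (i, m) * poly_at_mats kbar g X $$ (m, j))"
      using ij by (simp add: mat_trace_monom_mult coord_mult_basis trace)
    also have "\<dots> = Hg $$ (i, j)"
      using ij H1_carrier by (simp add: Hg scalar_prod_def lessThan_atLeast0)
    finally show "Hg $$ (i, j) = hermite_matrix ?I bs g $$ (i, j)"
      by simp
  qed (use H1_carrier in \<open>auto simp: Hg hermite_matrix_def len\<close>)
  ultimately show ?thesis
    using quot_basis_vanishing assms(16) by (simp add: I)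
qed

end
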